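(* Let $n>2$ be an integer. Assume that $(\mathcal{A},\mathcal{B})$ is an $(n,n)$-bounded 1-cross intersecting set pair system of size $m$ such that both $\mathcal{A}$ and $\mathcal{B}$ are 1-intersecting. Then $m\le \binom{n}{2}+1$. Moreover, if $n\ge 4$ and equality holds, then $\mathcal{H}=\mathcal{A}\cup\mathcal{B}$ is $n$-uniform and $n$-regular, that is, $|A_i|=|B_i|=n$ for $i=1,\dots,m$, and every vertex $v\in\bigcup_{i=1}^m (A_i\cup B_i)$ belongs to exactly $n$ members of $\mathcal{H}$.
   Context: A cross intersecting set pair system (SPS) of size $m\ge 2$ consists of finite sets $A_1,\dots,A_m$ and $B_1,\dots,B_m$ such that $A_i\cap B_i=\emptyset$ for every $1\le i\le m$ and $A_i\cap B_j\neq\emptyset$ for all $1\le i\neq j\le m$; one writes $\mathcal{A}=\{A_i\}_{i=1}^m$, $\mathcal{B}=\{B_i\}_{i=1}^m$. It is $(a,b)$-bounded if $|A_i|\le a$ and $|B_i|\le b$ for each $i$. It is 1-cross intersecting if $|A_i\cap B_j|=1$ for each $i\neq j$. The hypergraph $\mathcal{A}$ (resp. $\mathcal{B}$) is 1-intersecting if $|A_i\cap A_j|=1$ (resp. $|B_i\cap B_j|=1$) for all $i\ne j$. $\mathcal{H}$ is the hypergraph with the $2m$ edges $A_1,\dots,A_m,B_1,\dots,B_m$. *)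

theory Defs
  imports Main "HOL-Library.Multiset"
begin

text \<open>Set pair systems of size \<open>m\<close> are families \<open>A B :: nat \<Rightarrow> 'a set\<close>, of which only the
  values at the indices in \<open>{1..m}\<close> matter.\<close>

definition cross_intersecting_sps :: "nat \<Rightarrow> (nat \<Rightarrow> 'a set) \<Rightarrow> (nat \<Rightarrow> 'a set) \<Rightarrow> bool" where
  "cross_intersecting_sps m A B \<longleftrightarrow>
     m \<ge> 2 \<and>
     (\<forall>i\<in>{1..m}. finite (A i) \<and> finite (B i)) \<and>
     (\<forall>i\<in>{1..m}. A i \<inter> B i = {}) \<and>
     (\<forall>i\<in>{1..m}. \<forall>j\<in>{1..m}. i \<noteq> j \<longrightarrow> A i \<inter> B j \<noteq> {})"

definition sps_bounded ::
  "nat \<Rightarrow> nat \<Rightarrow> nat \<Rightarrow> (nat \<Rightarrow> 'a set) \<Rightarrow> (nat \<Rightarrow> 'a set) \<Rightarrow> bool" where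
  "sps_bounded a b m A B \<longleftrightarrow> (\<forall>i\<in>{1..m}. card (A i) \<le> a \<and> card (B i) \<le> b)"

definition one_cross_intersecting ::
  "nat \<Rightarrow> (nat \<Rightarrow> 'a set) \<Rightarrow> (nat \<Rightarrow> 'a set) \<Rightarrow> bool" where
  "one_cross_intersecting m A B \<longleftrightarrow>
     (\<forall>i\<in>{1..m}. \<forall>j\<in>{1..m}. i \<noteq> j \<longrightarrow> card (A i \<inter> B j) = 1)"

definition one_intersecting :: "nat \<Rightarrow> (nat \<Rightarrow> 'a set) \<Rightarrow> bool" where
  "one_intersecting m A \<longleftrightarrow>
     (\<forall>i\<in>{1..m}. \<forall>j\<in>{1..m}. i \<noteq> j \<longrightarrow> card (A i \<inter> A j) = 1)"

text \<open>Hypergraphs are multisets of edges, so that the hypergraph of a set pair system of size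
  \<open>m\<close> has exactly \<open>2 * m\<close> edges, and degrees count edges with multiplicity.\<close>

definition sps_hypergraph ::
  "nat \<Rightarrow> (nat \<Rightarrow> 'a set) \<Rightarrow> (nat \<Rightarrow> 'a set) \<Rightarrow> 'a set multiset" where
  "sps_hypergraph m A B =
     image_mset A (mset_set {1..m}) + image_mset B (mset_set {1..m})"

definition hypergraph_degree :: "'a set multiset \<Rightarrow> 'a \<Rightarrow> nat" where
  "hypergraph_degree H v = size (filter_mset (\<lambda>e. v \<in> e) H)"

definition uniform_hypergraph :: "nat \<Rightarrow> 'a set multiset \<Rightarrow> bool" where
  "uniform_hypergraph k H \<longleftrightarrow> (\<forall>e\<in>#H. card e = k)"

definition regular_hypergraph :: "nat \<Rightarrow> 'a set multiset \<Rightarrow> bool" where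
  "regular_hypergraph k H \<longleftrightarrow> (\<forall>v\<in>\<Union>(set_mset H). hypergraph_degree H v = k)"

end

theory Submission
  imports Defs
begin

text \<open>
  View the \<open>2 * m\<close> sets \<open>A i\<close>, \<open>B i\<close> as edges of one hypergraph, where each edge has a unique
  partner disjoint from it and meets every other edge in a single vertex. Counting
  the other edges along the vertices of a fixed edge \<open>e\<close> shows that the numbers \<open>d v - 1\<close>,
  for \<open>v \<in> e\<close>, add up to \<open>2 * m - 2\<close>, where \<open>d v\<close> is the degree of \<open>v\<close>
  (lemma \<open>sum_star_minus\<close>). If all degrees are at most \<open>n\<close>, then
  \<open>2 * m - 2 \<le> n * (n - 1)\<close>, which is the required bound, and equality forces \<open>e\<close> to have exactly
  \<open>n\<close> vertices, all of degree \<open>n\<close>.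

  Degrees above \<open>n\<close> are exceptional: the edges through \<open>v\<close> have no second
  vertex in common, so an edge \<open>e\<close> avoiding \<open>v\<close> meets them in different vertices, the
  partner of \<open>e\<close> being the only one that can miss \<open>e\<close>. Hence \<open>d v > n\<close> forces \<open>d v = n + 1\<close>, and forces
  the partner of every edge avoiding \<open>v\<close> to pass through \<open>v\<close>, so \<open>v\<close> lies on exactly one
  edge of each pair and \<open>m = n + 1\<close> (lemma \<open>card_edges_if_large_star\<close>). This respects the
  bound for \<open>n \<ge> 3\<close>, and stays strictly below it for \<open>n \<ge> 4\<close>.
\<close>

locale partnered_hypergraph =
  fixes I :: "'i set" and F :: "'i \<Rightarrow> 'a set" and p :: "'i \<Rightarrow> 'i" and n :: nat
  assumes finite_I: "finite I"
    and partner_in: "x \<in> I \<Longrightarrow> p x \<in> I"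
    and partner_partner: "x \<in> I \<Longrightarrow> p (p x) = x"
    and partner_neq: "x \<in> I \<Longrightarrow> p x \<noteq> x"
    and finite_edge: "x \<in> I \<Longrightarrow> finite (F x)"
    and card_edge: "x \<in> I \<Longrightarrow> card (F x) \<le> n"
    and partner_disjoint: "x \<in> I \<Longrightarrow> F x \<inter> F (p x) = {}"
    and card_meet: "x \<in> I \<Longrightarrow> y \<in> I \<Longrightarrow> y \<noteq> x \<Longrightarrow> y \<noteq> p x \<Longrightarrow> card (F x \<inter> F y) = 1"
begin

definition star :: "'a \<Rightarrow> 'i set" where
  "star v = {x \<in> I. v \<in> F x}"

lemma finite_star: "finite (star v)"
  using finite_I by (simp add: star_def)

text \<open>Every edge other than \<open>e\<close> and its partner meets \<open>e\<close> in one vertex, so it is counted at exactly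
  one \<open>v \<in> F e\<close>; the partner is never counted.\<close>

lemma sum_star_minus:
  assumes "e \<in> I"
  shows "(\<Sum>v\<in>F e. card (star v - {e})) = card I - 2"
proof -
  have "(\<Sum>v\<in>F e. card (star v - {e})) = (\<Sum>v\<in>F e. \<Sum>x\<in>I - {e}. if v \<in> F x then 1 else 0)"
  proof (rule sum.cong[OF refl])
    fix v
    have "star v - {e} = (I - {e}) \<inter> {x. v \<in> F x}"
      by (auto simp: star_def)
    then show "card (star v - {e}) = (\<Sum>x\<in>I - {e}. if v \<in> F x then 1 else 0)"
      using finite_I by (simp add: sum.If_cases)
  qed
  also have "\<dots> = (\<Sum>x\<in>I - {e}. \<Sum>v\<in>F e. if v \<in> F x then 1 else 0)"
    by (rule sum.swap)
  also have "\<dots> = (\<Sum>x\<in>I - {e}. card (F e \<inter> F x))"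
    using finite_edge[OF assms] by (intro sum.cong) (simp_all add: sum.If_cases)
  also have "\<dots> = (\<Sum>x\<in>I - {e, p e}. card (F e \<inter> F x))"
    using finite_I partner_disjoint[OF assms] by (intro sum.mono_neutral_right) auto
  also have "\<dots> = (\<Sum>x\<in>I - {e, p e}. 1)"
    using card_meet[OF assms] by (intro sum.cong) auto
  also have "\<dots> = card I - 2"
    using assms partner_in[OF assms] partner_neq[OF assms] finite_I
    by (simp add: card_Diff_subset)
  finally show ?thesis .
qed

text \<open>Two edges through \<open>v\<close> share only \<open>v\<close>, so they cut an edge avoiding \<open>v\<close> in disjoint traces.
  These traces are single vertices, except for the empty trace of the partner.\<close>

lemma card_star_minus_partner:
  assumes "e \<in> I" "v \<notin> F e"
  shows "card (star v - {p e}) \<le> n"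
proof -
  let ?S = "star v - {p e}"
  have disj: "(F e \<inter> F x) \<inter> (F e \<inter> F y) = {}" if "x \<in> ?S" "y \<in> ?S" "x \<noteq> y" for x y
  proof -
    have xy: "x \<in> I" "y \<in> I" "v \<in> F x \<inter> F y"
      using that by (auto simp: star_def)
    then have "card (F x \<inter> F y) = 1"
      using card_meet[of x y] partner_disjoint[of x] that(3) by auto
    then have "F x \<inter> F y = {v}"
      using xy(3) by (metis card_1_singletonE singletonD)
    then show ?thesis
      using assms(2) by auto
  qed
  have one: "card (F e \<inter> F x) = 1" if "x \<in> ?S" for x
    using that assms card_meet[of e x] by (auto simp: star_def)
  have "card ?S = (\<Sum>x\<in>?S. card (F e \<inter> F x))"
    using one by simp
  also have "\<dots> = card (\<Union>x\<in>?S. F e \<inter> F x)"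
    using disj finite_star finite_edge[OF assms(1)]
    by (intro card_UN_disjoint[symmetric]) auto
  also have "\<dots> \<le> card (F e)"
    using finite_edge[OF assms(1)] by (intro card_mono) auto
  also have "\<dots> \<le> n"
    by (rule card_edge[OF assms(1)])
  finally show ?thesis .
qed

text \<open>The partner of an edge through \<open>v\<close> avoids \<open>v\<close>. If both members of a pair avoided \<open>v\<close>,
  all the edges through \<open>v\<close> would meet either member in different vertices, too many for its
  size. So the star is a transversal of the partner pairs.\<close>

lemma card_edges_if_large_star:
  assumes "card (star v) > n"
  shows "card I = 2 * (n + 1)"
proof -
  have partner_avoids: "p x \<in> I - star v" if "x \<in> star v" for x
    using that partner_in[of x] partner_disjoint[of x] by (auto simp: star_def)
  have partner_hits: "p x \<in> star v" if "x \<in> I - star v" for x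
  proof (rule ccontr)
    assume "p x \<notin> star v"
    then have "star v - {p x} = star v" by simp
    then show False
      using card_star_minus_partner[of x v] that assms by (auto simp: star_def)
  qed
  have star_I: "star v \<subseteq> I"
    by (auto simp: star_def)
  have bij: "bij_betw p (star v) (I - star v)"
    using partner_avoids partner_hits star_I partner_partner
    by (intro bij_betw_byWitness[where f' = p]) blast+
  obtain e where e: "e \<in> star v"
    using assms by fastforce
  then have "card (star v - {p (p e)}) \<le> n"
    using partner_avoids[OF e] by (intro card_star_minus_partner) (auto simp: star_def)
  then have "card (star v) = n + 1"
    using e star_I partner_partner[of e] assms finite_star[of v] by auto
  moreover have "card I = card (star v) + card (I - star v)"
    using star_I finite_I finite_star by (simp add: card_Diff_subset card_mono)
  ultimately show ?thesis
    using bij_betw_same_card[OF bij] by simp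
qed

lemma card_edges_le_if_small_stars:
  assumes small: "\<And>v. card (star v) \<le> n" and "e \<in> I"
  shows "card I - 2 \<le> n * (n - 1)"
proof -
  have "card I - 2 = (\<Sum>v\<in>F e. card (star v - {e}))"
    using sum_star_minus[OF \<open>e \<in> I\<close>] by simp
  also have "\<dots> \<le> (\<Sum>v\<in>F e. n - 1)"
    using small finite_star \<open>e \<in> I\<close> by (intro sum_mono) (simp add: star_def diff_le_mono)
  also have "\<dots> \<le> n * (n - 1)"
    using card_edge[OF \<open>e \<in> I\<close>] by (simp add: mult_le_mono1)
  finally show ?thesis .
qed

text \<open>Equality in the previous bound leaves no slack either in the size of \<open>e\<close> or in the degree of any
  of its vertices. For \<open>n = 1\<close> the factor \<open>n - 1\<close> would vanish and the size of \<open>e\<close> could not be recovered.\<close>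

lemma tight_if_small_stars:
  assumes small: "\<And>v. card (star v) \<le> n" and "e \<in> I"
    and tight: "card I - 2 = n * (n - 1)" and "n \<ge> 2"
  shows "card (F e) = n" and "v \<in> F e \<Longrightarrow> card (star v) = n"
proof -
  have sum_eq: "(\<Sum>v\<in>F e. card (star v - {e})) = n * (n - 1)"
    using sum_star_minus[OF \<open>e \<in> I\<close>] tight by simp
  have minus: "card (star v - {e}) = card (star v) - 1" "card (star v) \<ge> 1" if "v \<in> F e" for v
  proof -
    have "e \<in> star v"
      using that \<open>e \<in> I\<close> by (simp add: star_def)
    then show "card (star v - {e}) = card (star v) - 1" "card (star v) \<ge> 1"
      using finite_star[of v] by (auto simp: Suc_le_eq card_gt_0_iff)
  qed
  have le: "card (star v - {e}) \<le> n - 1" if "v \<in> F e" for v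
    using minus(1)[OF that] small[of v] by simp
  have "n * (n - 1) \<le> card (F e) * (n - 1)"
    using sum_mono[of "F e" "\<lambda>v. card (star v - {e})" "\<lambda>_. n - 1"] le sum_eq by simp
  then show card: "card (F e) = n"
    using card_edge[OF \<open>e \<in> I\<close>] \<open>n \<ge> 2\<close> by simp
  show "card (star v) = n" if "v \<in> F e"
  proof (rule ccontr)
    assume "card (star v) \<noteq> n"
    then have "card (star v - {e}) < n - 1"
      using small[of v] minus[OF that] by linarith
    then have "(\<Sum>v\<in>F e. card (star v - {e})) < (\<Sum>v\<in>F e. n - 1)"
      using le that finite_edge[OF \<open>e \<in> I\<close>] by (intro sum_strict_mono_ex1) auto
    then show False
      using sum_eq card by simp
  qed
qed

end

lemma double_choose_two: "2 * (n choose 2) = n * (n - 1)"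
proof -
  have "even (n * (n - 1))"
    by (cases n) auto
  then show ?thesis
    by (simp add: choose_two)
qed

text \<open>Edges are indexed by pairs of a position and a side, the partner of an edge being the other
  side at the same position. The index, rather than the set, is the edge, so coinciding sets
  would still count twice, as they do in the multiset.\<close>

theorem theorem1p7:
  fixes n m :: nat and A B :: "nat \<Rightarrow> 'a set"
  assumes "n > 2"
    and "cross_intersecting_sps m A B"
    and "sps_bounded n n m A B"
    and "one_cross_intersecting m A B"
    and "one_intersecting m A"
    and "one_intersecting m B"
  shows "m \<le> (n choose 2) + 1 \<and>
    (n \<ge> 4 \<and> m = (n choose 2) + 1 \<longrightarrow>
       uniform_hypergraph n (sps_hypergraph m A B) \<and>
       regular_hypergraph n (sps_hypergraph m A B))"
proof -
  define I :: "(nat \<times> bool) set" where "I = {1..m} \<times> UNIV"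
  define F where "F = (\<lambda>(i, b). if b then A i else B i)"
  define p :: "nat \<times> bool \<Rightarrow> nat \<times> bool" where "p = (\<lambda>(i, b). (i, \<not> b))"
  note sps = assms(2)[unfolded cross_intersecting_sps_def]
  note bounded = assms(3)[unfolded sps_bounded_def]
  note cross = assms(4)[unfolded one_cross_intersecting_def]
  note A_meet = assms(5)[unfolded one_intersecting_def]
  note B_meet = assms(6)[unfolded one_intersecting_def]
  have A_B_disjoint: "v \<notin> B i" if "v \<in> A i" "i \<in> {1..m}" for v i
    using that sps by blast
  interpret partnered_hypergraph I F p n
  proof
    fix x y
    assume xy: "x \<in> I" "y \<in> I" "y \<noteq> x" "y \<noteq> p x"
    obtain i b j c where [simp]: "x = (i, b)" "y = (j, c)"
      by (metis surj_pair)
    have "i \<in> {1..m}" "j \<in> {1..m}" "i \<noteq> j"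
      using xy by (auto simp: I_def p_def)
    then show "card (F x \<inter> F y) = 1"
      using cross A_meet B_meet by (cases b; cases c) (auto simp: F_def Int_commute)
  qed (use sps bounded A_B_disjoint in \<open>auto simp: I_def F_def p_def split: if_splits\<close>)
  have card_I: "card I = 2 * m"
    by (simp add: I_def)
  have "m \<ge> 2"
    using sps by simp
  then have e: "(1, True) \<in> I"
    by (simp add: I_def)
  have degree: "hypergraph_degree (sps_hypergraph m A B) v = card (star v)" for v
  proof -
    have "star v = {i \<in> {1..m}. v \<in> A i} \<times> {True} \<union> {i \<in> {1..m}. v \<in> B i} \<times> {False}"
      unfolding star_def by (auto simp: I_def F_def split: if_splits)
    then have "card (star v) = card {i \<in> {1..m}. v \<in> A i} + card {i \<in> {1..m}. v \<in> B i}"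
      by (simp add: card_Un_disjoint card_cartesian_product Int_commute disjoint_iff)
    then show ?thesis
      by (simp add: hypergraph_degree_def sps_hypergraph_def filter_mset_image_mset)
  qed
  have edges: "set_mset (sps_hypergraph m A B) = F ` I"
  proof -
    have "I = {1..m} \<times> {True} \<union> {1..m} \<times> {False}"
      by (auto simp: I_def)
    moreover have "F ` ({1..m} \<times> {True}) = A ` {1..m}" "F ` ({1..m} \<times> {False}) = B ` {1..m}"
      by (force simp: F_def)+
    ultimately show ?thesis
      by (simp add: sps_hypergraph_def image_Un)
  qed
  show ?thesis
  proof (cases "\<exists>v. card (star v) > n")
    case True
    then have "2 * m = 2 * (n + 1)"
      using card_edges_if_large_star card_I by metis
    then have m: "m = n + 1"
      by simp
    have "n * 2 \<le> n * (n - 1)"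
      using assms(1) by (intro mult_le_mono2) simp
    then have "n \<le> (n choose 2)"
      using double_choose_two[of n] by linarith
    moreover have "n < (n choose 2)" if "n \<ge> 4"
    proof -
      have "n * 3 \<le> n * (n - 1)"
        using that by (intro mult_le_mono2) simp
      then show ?thesis
        using double_choose_two[of n] that by linarith
    qed
    ultimately show ?thesis
      using m by auto
  next
    case False
    then have small: "\<And>v. card (star v) \<le> n"
      by (simp add: not_less)
    have "m \<le> (n choose 2) + 1"
      using card_edges_le_if_small_stars[OF small e] card_I double_choose_two[of n] by simp
    moreover have "uniform_hypergraph n (sps_hypergraph m A B) \<and>
        regular_hypergraph n (sps_hypergraph m A B)" if "m = (n choose 2) + 1"
    proof -
      have tight: "card I - 2 = n * (n - 1)"
        using that card_I double_choose_two[of n] by simp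
      show ?thesis
        unfolding uniform_hypergraph_def regular_hypergraph_def edges degree
        using tight_if_small_stars[OF small _ tight] assms(1) by auto
    qed
    ultimately show ?thesis by simp
  qed
qed

end
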